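(* For any mesh sizes $h,\tau$ (with $h$ as in the standing assumption of the context), the implicit scheme $$\frac{g^{n+1}(x)-g^n(x)}{\tau}+\frac12\sum_{j=1}^3\Big(w^n_j(x-he^j)D^+_jg^{n+1}(x-he^j)+w^n_j(x)D^+_jg^{n+1}(x)\Big)=0,\quad x\in\Omega_h\setminus\partial\Omega_h,$$ $$g^{n+1}|_{\partial\Omega_h}=0,\qquad n=0,\dots,T_\tau-1,$$ with unknowns $g^1,\dots,g^{T_\tau}:\Omega_h\to\mathbb{R}$ and $g^0$ given in the context, is uniquely solvable. Furthermore, the solution satisfies $$\|g^n\|_{2,\Omega_h}\le\|g^0\|_{2,\Omega_h}\le\|f^0\|_{L^2(\Omega)},\qquad\forall\,n=0,1,\dots,T_\tau .$$
   Context: Setting. $T>0$; $\Omega\subset\mathbb{R}^3$ is a bounded connected open set; $v\in L^2([0,T];H^1_0(\Omega)^3)\cap L^\infty([0,T];L^2(\Omega)^3)$ with $\nabla\cdot v=0$ and $\mathrm{supp}(v)\subset[0,T]\times\Omega$ (so $v$ vanishes for $x$ near $\partial\Omega$); $f^0\in L^2(\Omega)$ with $f^0\equiv0$ in a neighborhood of $\partial\Omega$. Grid. $h,\tau>0$ are the space and time mesh sizes; $T_\tau\in\mathbb{N}$ is such that $T\in[\tau T_\tau,\tau T_\tau+\tau)$. $e^1,e^2,e^3$ is the standard basis of $\mathbb{R}^3$; $C_h(x)=\prod_{i=1}^3[x_i-\frac h2,x_i+\frac h2)$; $\Omega_h=\{x\in\Omega\cap h\mathbb{Z}^3:C_{2h}(x)\subset\Omega\}$;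 the boundary of $A\subset h\mathbb{Z}^3$ is $\partial A=\{x\in A:\{x\pm he^i:i=1,2,3\}\not\subset A\}$. $D^+_i\phi(x)=\frac{\phi(x+he^i)-\phi(x)}h$, $D^-_i\phi(x)=\frac{\phi(x)-\phi(x-he^i)}h$, $D^\pm=(D^\pm_1,D^\pm_2,D^\pm_3)$, where functions on $\Omega_h$ are always extended by $0$ outside $\Omega_h$. $\|\phi\|_{2,\Omega_h}=(\sum_{x\in\Omega_h}|\phi(x)|^2h^3)^{1/2}$. Discrete data. $g^0(x)=\frac1{h^3}\int_{C_h(x)}f^0(y)\,dy$ and $u^n_i(x)=\frac1{\tau h^3}\int_{\tau n}^{\tau(n+1)}\int_{C_h(x)}v_i(s,y)\,dy\,ds$ for $x\in\Omega_h$, $0\le n\le T_\tau-1$. Standing assumption: $h$ is small enough that $g^0$ and all $u^n$ vanish near (in particular on) $\partial\Omega_h$. Discrete Helmholtz-Hodge projection. It is known that for each $u:\Omega_h\to\mathbb{R}^3$ there are unique $w:\Omega_h\to\mathbb{R}^3$ and $\phi:\Omega_h\to\mathbb{R}$ with $D^-\cdot w=0$ and $w+D^+\phi=u$ on $\Omega_h\setminus\partial\Omega_h$, and $w=0$, $\phi=0$ on $\partial\Omega_h$; one writes $P_hu:=w$. Set $w^n:=P_hu^n$. *)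

theory Defs
  imports "HOL-Analysis.Analysis"
begin

section \<open>Function spaces on a domain\<close>

text \<open>
  Elements of Lebesgue and Sobolev spaces are represented by functions on all of
  \<open>\<real>\<^sup>3\<close>, of which only the values on \<open>\<Omega>\<close> up to null sets matter.
  Consequently, the functions \<open>L2_norm\<close>, \<open>H1_norm\<close> below are norms on equivalence classes only.
\<close>

definition L2_space :: "(real^3) set \<Rightarrow> (real^3 \<Rightarrow> 'b::euclidean_space) set" where
  "L2_space \<Omega> = {f. f \<in> borel_measurable (lebesgue_on \<Omega>) \<and>
                     integrable (lebesgue_on \<Omega>) (\<lambda>x. (norm (f x))\<^sup>2)}"

definition L2_norm :: "(real^3) set \<Rightarrow> (real^3 \<Rightarrow> 'b::euclidean_space) \<Rightarrow> real" where
  "L2_norm \<Omega> f = sqrt (\<integral>x. (norm (f x))\<^sup>2 \<partial>lebesgue_on \<Omega>)"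

definition partial_deriv :: "3 \<Rightarrow> (real^3 \<Rightarrow> real) \<Rightarrow> real^3 \<Rightarrow> real" where
  "partial_deriv i f x = frechet_derivative f (at x) (axis i 1)"

primrec C_k :: "nat \<Rightarrow> (real^3 \<Rightarrow> real) \<Rightarrow> bool" where
  "C_k 0 f \<longleftrightarrow> continuous_on UNIV f"
| "C_k (Suc k) f \<longleftrightarrow> (\<forall>x. f differentiable (at x)) \<and> (\<forall>i. C_k k (partial_deriv i f))"

definition test_functions :: "(real^3) set \<Rightarrow> (real^3 \<Rightarrow> real) set" where
  "test_functions \<Omega> = {\<phi>. (\<forall>k. C_k k \<phi>) \<and>
     compact (closure {x. \<phi> x \<noteq> 0}) \<and> closure {x. \<phi> x \<noteq> 0} \<subseteq> \<Omega>}"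

definition has_weak_partial ::
    "(real^3) set \<Rightarrow> 3 \<Rightarrow> (real^3 \<Rightarrow> real) \<Rightarrow> (real^3 \<Rightarrow> real) \<Rightarrow> bool" where
  "has_weak_partial \<Omega> i f g \<longleftrightarrow>
     (\<forall>\<phi> \<in> test_functions \<Omega>.
        (\<integral>x. f x * partial_deriv i \<phi> x \<partial>lebesgue_on \<Omega>) = - (\<integral>x. g x * \<phi> x \<partial>lebesgue_on \<Omega>))"

definition H1_space :: "(real^3) set \<Rightarrow> (real^3 \<Rightarrow> real) set" where
  "H1_space \<Omega> = {f \<in> L2_space \<Omega>. \<forall>i. \<exists>g \<in> L2_space \<Omega>. has_weak_partial \<Omega> i f g}"

text \<open>For \<open>f \<in> H1_space \<Omega>\<close> the following choice is unique up to null sets.\<close>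

definition weak_partial :: "(real^3) set \<Rightarrow> 3 \<Rightarrow> (real^3 \<Rightarrow> real) \<Rightarrow> real^3 \<Rightarrow> real" where
  "weak_partial \<Omega> i f = (SOME g. g \<in> L2_space \<Omega> \<and> has_weak_partial \<Omega> i f g)"

definition H1_norm :: "(real^3) set \<Rightarrow> (real^3 \<Rightarrow> real) \<Rightarrow> real" where
  "H1_norm \<Omega> f = sqrt ((L2_norm \<Omega> f)\<^sup>2 + (\<Sum>i\<in>UNIV. (L2_norm \<Omega> (weak_partial \<Omega> i f))\<^sup>2))"

definition H10_space :: "(real^3) set \<Rightarrow> (real^3 \<Rightarrow> real) set" where
  "H10_space \<Omega> = {f \<in> H1_space \<Omega>.
     \<exists>\<phi>. (\<forall>k::nat. \<phi> k \<in> test_functions \<Omega>) \<and>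
         (\<lambda>k. H1_norm \<Omega> (\<lambda>x. \<phi> k x - f x)) \<longlonglongrightarrow> 0}"

definition H10_vec :: "(real^3) set \<Rightarrow> (real^3 \<Rightarrow> real^3) set" where
  "H10_vec \<Omega> = {f. \<forall>i. (\<lambda>x. f x $ i) \<in> H10_space \<Omega>}"

definition H1_norm_vec :: "(real^3) set \<Rightarrow> (real^3 \<Rightarrow> real^3) \<Rightarrow> real" where
  "H1_norm_vec \<Omega> f = sqrt (\<Sum>i\<in>UNIV. (H1_norm \<Omega> (\<lambda>x. f x $ i))\<^sup>2)"


section \<open>Bochner spaces on a time interval\<close>

text \<open>
  \<open>X\<close> is a space of (representatives of) functions with norm \<open>N\<close>; strong measurability is
  almost everywhere approximability in \<open>N\<close> by \<open>X\<close>-valued simple functions.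
\<close>

definition bochner_measurable ::
    "real \<Rightarrow> ('a \<Rightarrow> 'b::real_normed_vector) set \<Rightarrow> (('a \<Rightarrow> 'b) \<Rightarrow> real) \<Rightarrow>
     (real \<Rightarrow> 'a \<Rightarrow> 'b) \<Rightarrow> bool" where
  "bochner_measurable T X N F \<longleftrightarrow>
     (AE t in lebesgue_on {0..T}. F t \<in> X) \<and>
     (\<exists>s :: nat \<Rightarrow> real \<Rightarrow> 'a \<Rightarrow> 'b.
        (\<forall>k. simple_function (lebesgue_on {0..T}) (s k) \<and> (\<forall>t\<in>{0..T}. s k t \<in> X)) \<and>
        (AE t in lebesgue_on {0..T}. (\<lambda>k. N (\<lambda>x. s k t x - F t x)) \<longlonglongrightarrow> 0))"

definition bochner_L2 ::
    "real \<Rightarrow> ('a \<Rightarrow> 'b::real_normed_vector) set \<Rightarrow> (('a \<Rightarrow> 'b) \<Rightarrow> real) \<Rightarrow>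
     (real \<Rightarrow> 'a \<Rightarrow> 'b) set" where
  "bochner_L2 T X N = {F. bochner_measurable T X N F \<and>
                          integrable (lebesgue_on {0..T}) (\<lambda>t. (N (F t))\<^sup>2)}"

definition bochner_Linf ::
    "real \<Rightarrow> ('a \<Rightarrow> 'b::real_normed_vector) set \<Rightarrow> (('a \<Rightarrow> 'b) \<Rightarrow> real) \<Rightarrow>
     (real \<Rightarrow> 'a \<Rightarrow> 'b) set" where
  "bochner_Linf T X N = {F. bochner_measurable T X N F \<and>
                            (\<exists>C. AE t in lebesgue_on {0..T}. N (F t) \<le> C)}"

text \<open>
  The support of a function defined up to null sets: a point is outside the support iff the
  function vanishes almost everywhere near it. It is closed in the whole ambient space, so a
  support contained in \<open>{0..T} \<times> \<Omega>\<close> stays away from the lateral boundary.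
\<close>

definition ess_support :: "'a::euclidean_space set \<Rightarrow> ('a \<Rightarrow> 'b::real_normed_vector) \<Rightarrow> 'a set" where
  "ess_support S f = {p. \<forall>U. open U \<and> p \<in> U \<longrightarrow> \<not> (AE q in lebesgue_on S. q \<in> U \<longrightarrow> f q = 0)}"

definition weakly_div_free ::
    "real \<Rightarrow> (real^3) set \<Rightarrow> (real \<times> (real^3) \<Rightarrow> real^3) \<Rightarrow> bool" where
  "weakly_div_free T \<Omega> v \<longleftrightarrow>
     (AE t in lebesgue_on {0..T}. AE x in lebesgue_on \<Omega>.
        (\<Sum>i\<in>UNIV. weak_partial \<Omega> i (\<lambda>y. v (t, y) $ i) x) = 0)"

text \<open>
  The field \<open>v\<close> is given by a jointly measurable representative.
\<close>

definition admissible_velocity ::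
    "real \<Rightarrow> (real^3) set \<Rightarrow> (real \<times> (real^3) \<Rightarrow> real^3) \<Rightarrow> bool" where
  "admissible_velocity T \<Omega> v \<longleftrightarrow>
     v \<in> borel_measurable (lebesgue_on ({0..T} \<times> \<Omega>)) \<and>
     (\<lambda>t x. v (t, x)) \<in> bochner_L2 T (H10_vec \<Omega>) (H1_norm_vec \<Omega>) \<and>
     (\<lambda>t x. v (t, x)) \<in> bochner_Linf T (L2_space \<Omega>) (L2_norm \<Omega>) \<and>
     weakly_div_free T \<Omega> v \<and>
     ess_support ({0..T} \<times> \<Omega>) v \<subseteq> {0..T} \<times> \<Omega>"

definition admissible_initial :: "(real^3) set \<Rightarrow> (real^3 \<Rightarrow> real) \<Rightarrow> bool" where
  "admissible_initial \<Omega> f \<longleftrightarrow> f \<in> L2_space \<Omega> \<and>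
     (\<exists>U. open U \<and> frontier \<Omega> \<subseteq> U \<and> (AE x in lebesgue_on \<Omega>. x \<in> U \<longrightarrow> f x = 0))"


section \<open>The grid\<close>

definition cube :: "real \<Rightarrow> real^3 \<Rightarrow> (real^3) set" where
  "cube h x = {y. \<forall>i. x $ i - h / 2 \<le> y $ i \<and> y $ i < x $ i + h / 2}"

definition scaled_lattice :: "real \<Rightarrow> (real^3) set" where
  "scaled_lattice h = {x. \<forall>i. \<exists>k::int. x $ i = h * of_int k}"

definition grid :: "(real^3) set \<Rightarrow> real \<Rightarrow> (real^3) set" where
  "grid \<Omega> h = {x \<in> \<Omega> \<inter> scaled_lattice h. cube (2 * h) x \<subseteq> \<Omega>}"

definition grid_boundary :: "real \<Rightarrow> (real^3) set \<Rightarrow> (real^3) set" where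
  "grid_boundary h A =
     {x \<in> A. \<not> ((\<Union>i. {x + h *\<^sub>R axis i 1, x - h *\<^sub>R axis i 1}) \<subseteq> A)}"

definition grid_interior :: "real \<Rightarrow> (real^3) set \<Rightarrow> (real^3) set" where
  "grid_interior h A = A - grid_boundary h A"

text \<open>Functions on \<open>A\<close> are identified with their extensions by zero.\<close>

definition grid_fun :: "(real^3) set \<Rightarrow> (real^3 \<Rightarrow> 'b::zero) set" where
  "grid_fun A = {\<phi>. \<forall>x. x \<notin> A \<longrightarrow> \<phi> x = 0}"

definition Dplus :: "real \<Rightarrow> 3 \<Rightarrow> (real^3 \<Rightarrow> real) \<Rightarrow> real^3 \<Rightarrow> real" where
  "Dplus h i \<phi> x = (\<phi> (x + h *\<^sub>R axis i 1) - \<phi> x) / h"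

definition Dminus :: "real \<Rightarrow> 3 \<Rightarrow> (real^3 \<Rightarrow> real) \<Rightarrow> real^3 \<Rightarrow> real" where
  "Dminus h i \<phi> x = (\<phi> x - \<phi> (x - h *\<^sub>R axis i 1)) / h"

definition grad_plus :: "real \<Rightarrow> (real^3 \<Rightarrow> real) \<Rightarrow> real^3 \<Rightarrow> real^3" where
  "grad_plus h \<phi> x = (\<chi> i. Dplus h i \<phi> x)"

definition div_minus :: "real \<Rightarrow> (real^3 \<Rightarrow> real^3) \<Rightarrow> real^3 \<Rightarrow> real" where
  "div_minus h w x = (\<Sum>i\<in>UNIV. Dminus h i (\<lambda>y. w y $ i) x)"

definition grid_norm :: "real \<Rightarrow> (real^3) set \<Rightarrow> (real^3 \<Rightarrow> real) \<Rightarrow> real" where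
  "grid_norm h A \<phi> = sqrt (\<Sum>x\<in>A. \<bar>\<phi> x\<bar>\<^sup>2 * h ^ 3)"


section \<open>Discrete data\<close>

definition g_init :: "(real^3) set \<Rightarrow> real \<Rightarrow> (real^3 \<Rightarrow> real) \<Rightarrow> real^3 \<Rightarrow> real" where
  "g_init \<Omega> h f x =
     (if x \<in> grid \<Omega> h then 1 / h ^ 3 * (\<integral>y. f y \<partial>lebesgue_on (cube h x)) else 0)"

definition u_data ::
    "(real^3) set \<Rightarrow> real \<Rightarrow> real \<Rightarrow> (real \<times> (real^3) \<Rightarrow> real^3) \<Rightarrow> nat \<Rightarrow> real^3 \<Rightarrow> real^3" where
  "u_data \<Omega> h \<tau> v n x =
     (if x \<in> grid \<Omega> h then
        (\<chi> i. 1 / (\<tau> * h ^ 3) *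
           (\<integral>s. (\<integral>y. v (s, y) $ i \<partial>lebesgue_on (cube h x))
              \<partial>lebesgue_on {\<tau> * real n .. \<tau> * (real n + 1)}))
      else 0)"


section \<open>Discrete Helmholtz--Hodge projection and the implicit scheme\<close>

definition is_helmholtz_decomp ::
    "(real^3) set \<Rightarrow> real \<Rightarrow> (real^3 \<Rightarrow> real^3) \<Rightarrow> (real^3 \<Rightarrow> real^3) \<Rightarrow> (real^3 \<Rightarrow> real) \<Rightarrow> bool" where
  "is_helmholtz_decomp \<Omega> h u w \<phi> \<longleftrightarrow>
     w \<in> grid_fun (grid \<Omega> h) \<and> \<phi> \<in> grid_fun (grid \<Omega> h) \<and>
     (\<forall>x \<in> grid_interior h (grid \<Omega> h). div_minus h w x = 0 \<and> w x + grad_plus h \<phi> x = u x) \<and>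
     (\<forall>x \<in> grid_boundary h (grid \<Omega> h). w x = 0 \<and> \<phi> x = 0)"

text \<open>The pair \<open>(w, \<phi>)\<close> is unique for bounded \<open>\<Omega>\<close> and \<open>h > 0\<close>.\<close>

definition helmholtz_proj ::
    "(real^3) set \<Rightarrow> real \<Rightarrow> (real^3 \<Rightarrow> real^3) \<Rightarrow> real^3 \<Rightarrow> real^3" where
  "helmholtz_proj \<Omega> h u = fst (THE (w, \<phi>). is_helmholtz_decomp \<Omega> h u w \<phi>)"

definition w_data ::
    "(real^3) set \<Rightarrow> real \<Rightarrow> real \<Rightarrow> (real \<times> (real^3) \<Rightarrow> real^3) \<Rightarrow> nat \<Rightarrow> real^3 \<Rightarrow> real^3" where
  "w_data \<Omega> h \<tau> v n = helmholtz_proj \<Omega> h (u_data \<Omega> h \<tau> v n)"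

text \<open>
  The sequence is indexed by \<open>{0..N}\<close>; \<open>g 0\<close> is the prescribed initial datum,
  so the unknowns are \<open>g 1, \<dots>, g N\<close>.
\<close>

definition solves_scheme ::
    "(real^3) set \<Rightarrow> real \<Rightarrow> real \<Rightarrow> nat \<Rightarrow> (nat \<Rightarrow> real^3 \<Rightarrow> real^3) \<Rightarrow> (real^3 \<Rightarrow> real) \<Rightarrow>
     (nat \<Rightarrow> real^3 \<Rightarrow> real) \<Rightarrow> bool" where
  "solves_scheme \<Omega> h \<tau> N w g0 g \<longleftrightarrow>
     g \<in> {0..N} \<rightarrow>\<^sub>E grid_fun (grid \<Omega> h) \<and>
     g 0 = g0 \<and>
     (\<forall>n<N.
        (\<forall>x \<in> grid_interior h (grid \<Omega> h).
           (g (Suc n) x - g n x) / \<tau>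
           + 1 / 2 * (\<Sum>j\<in>UNIV.
                 w n (x - h *\<^sub>R axis j 1) $ j * Dplus h j (g (Suc n)) (x - h *\<^sub>R axis j 1)
               + w n x $ j * Dplus h j (g (Suc n)) x) = 0) \<and>
        (\<forall>x \<in> grid_boundary h (grid \<Omega> h). g (Suc n) x = 0))"

end

theory Submission
  imports Defs
begin

text \<open>
  Both the Helmholtz--Hodge decomposition and one step of the scheme are square linear systems
  for functions supported on the grid interior, so they are uniquely solvable as soon as the
  kernel is trivial. For the decomposition, eliminating \<open>w\<close> leaves a Poisson equation for \<open>\<phi>\<close>, and
  summation by parts shows that an element of the kernel has zero gradient. For the scheme, testing
  with \<open>g\<^sup>n\<^sup>+\<^sup>1\<close> annihilates the transport term, because the products of neighbouring values
  telescope and the remaining terms add up to the divergence of \<open>w\<^sup>n\<close>; this gives the energy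
  inequality and, with zero data, the trivial kernel. The bound on the initial datum is Jensen's
  inequality on each of the disjoint cubes.
\<close>

section \<open>Linear systems on a finite index set\<close>

text \<open>Gaussian elimination by induction on the equations: a new equation is either void or can
  be solved for one unknown, which uses up one equation and one unknown and keeps the strict
  inequality.\<close>

lemma underdetermined_homogeneous_system:
  fixes a :: "'e \<Rightarrow> 'u \<Rightarrow> real"
  assumes "finite E" "finite U" "card E < card U"
  shows "\<exists>c. (\<exists>u\<in>U. c u \<noteq> 0) \<and> (\<forall>e\<in>E. (\<Sum>u\<in>U. a e u * c u) = 0)"
  using assms
proof (induction E arbitrary: U a rule: finite_induct)
  case empty
  then have "U \<noteq> {}" by auto
  then show ?case by (intro exI[of _ "\<lambda>_. 1"]) auto
next
  case (insert e E)
  show ?case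
  proof (cases "\<forall>u\<in>U. a e u = 0")
    case True
    have "card E < card U" using insert by simp
    with insert.IH[of U a] insert.prems obtain c
      where "\<exists>u\<in>U. c u \<noteq> 0" "\<forall>e\<in>E. (\<Sum>u\<in>U. a e u * c u) = 0" by blast
    with True show ?thesis by (intro exI[of _ c]) simp
  next
    case False
    then obtain p where p: "p \<in> U" "a e p \<noteq> 0" by blast
    \<comment> \<open>Row operation with pivot \<open>a e p\<close>: subtracting a multiple of row
      \<open>e\<close> clears the coefficient of \<open>p\<close>.\<close>
    define a' where "a' e' u = a e' u - a e' p * a e u / a e p" for e' u
    have "card E < card (U - {p})" using insert p by simp
    with insert.IH[of "U - {p}" a'] insert.prems obtain c
      where c: "\<exists>u\<in>U - {p}. c u \<noteq> 0"
        and c0: "\<forall>e'\<in>E. (\<Sum>u\<in>U - {p}. a' e' u * c u) = 0" by blast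
    define s where "s = (\<Sum>u\<in>U - {p}. a e u * c u)"
    \<comment> \<open>The value at \<open>p\<close> is forced by equation \<open>e\<close>, whose
      other terms add up to \<open>s\<close>.\<close>
    define d where "d = c(p := - s / a e p)"
    have split: "(\<Sum>u\<in>U. a e' u * d u) = a e' p * (- s / a e p) + (\<Sum>u\<in>U - {p}. a e' u * c u)" for e'
      using p insert.prems by (simp add: sum.remove[of U p] d_def)
    have "(\<Sum>u\<in>U. a e' u * d u) = 0" if "e' \<in> E" for e'
    proof -
      have "0 = (\<Sum>u\<in>U - {p}. a' e' u * c u)" using c0 that by simp
      also have "\<dots> = (\<Sum>u\<in>U - {p}. a e' u * c u) - a e' p / a e p * s"
        unfolding a'_def s_def by (simp add: sum_distrib_left sum_subtractf algebra_simps)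
      finally show ?thesis unfolding split by simp
    qed
    moreover have "(\<Sum>u\<in>U. a e u * d u) = 0" using p by (simp add: split s_def[symmetric])
    moreover have "\<exists>u\<in>U. d u \<noteq> 0" using c by (auto simp: d_def)
    ultimately show ?thesis by blast
  qed
qed

text \<open>Adjoining the right-hand side \<open>b\<close> as one more unknown makes the system underdetermined.\<close>

lemma trivial_kernel_imp_uniquely_solvable:
  fixes L :: "('a \<Rightarrow> real) \<Rightarrow> 'a \<Rightarrow> real"
  assumes fin: "finite S"
    and add: "\<And>f g x. x \<in> S \<Longrightarrow> L (\<lambda>y. f y + g y) x = L f x + L g x"
    and scale: "\<And>c f x. x \<in> S \<Longrightarrow> L (\<lambda>y. c * f y) x = c * L f x"
    and ker: "\<And>f. \<forall>x. x \<notin> S \<longrightarrow> f x = 0 \<Longrightarrow> \<forall>x\<in>S. L f x = 0 \<Longrightarrow> \<forall>x. f x = 0"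
  shows "\<exists>!f. (\<forall>x. x \<notin> S \<longrightarrow> f x = 0) \<and> (\<forall>x\<in>S. L f x = b x)"
proof (rule ex_ex1I)
  define \<delta> where "\<delta> s = (\<lambda>y. if y = s then 1 else 0 :: real)" for s :: 'a
  \<comment> \<open>\<open>Some s\<close> stands for the value of the solution at \<open>s\<close>,
    \<open>None\<close> for a common factor in front of \<open>b\<close>; a nontrivial solution then
    gives \<open>L f = c None * b\<close>.\<close>
  define a where "a x u = (case u of Some s \<Rightarrow> L (\<delta> s) x | None \<Rightarrow> - b x)" for x u
  have "card S < card (insert None (Some ` S))"
    using fin by (simp add: card_image)
  with underdetermined_homogeneous_system[of S "insert None (Some ` S)" a] fin obtain c
    where c: "\<exists>u\<in>insert None (Some ` S). c u \<noteq> 0"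
      and c0: "\<forall>x\<in>S. (\<Sum>u\<in>insert None (Some ` S). a x u * c u) = 0" by auto
  define f where "f y = (\<Sum>s\<in>S. c (Some s) * \<delta> s y)" for y
  have f_eq: "f y = (if y \<in> S then c (Some y) else 0)" for y
  proof -
    have "f y = (\<Sum>s\<in>S. if s = y then c (Some s) else 0)"
      unfolding f_def \<delta>_def by (rule sum.cong) auto
    then show ?thesis using fin by simp
  qed
  have Lsum: "L (\<lambda>y. \<Sum>s\<in>R. c (Some s) * \<delta> s y) x = (\<Sum>s\<in>R. c (Some s) * L (\<delta> s) x)"
    if "finite R" "x \<in> S" for R x
    using that(1)
  proof (induction R rule: finite_induct)
    case empty
    show ?case using scale[OF that(2), of 0 "\<lambda>_. 0"] by simp
  next
    case (insert s R)
    then show ?case using add[OF that(2)] scale[OF that(2)] by simp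
  qed
  have Lf: "L f x = b x * c None" if "x \<in> S" for x
  proof -
    have "(\<Sum>u\<in>insert None (Some ` S). a x u * c u) = - b x * c None + (\<Sum>s\<in>S. L (\<delta> s) x * c (Some s))"
      using fin by (simp add: a_def sum.reindex)
    moreover have "L f x = (\<Sum>s\<in>S. c (Some s) * L (\<delta> s) x)"
      using Lsum[OF fin that] unfolding f_def[abs_def] .
    ultimately show ?thesis using c0 that by (simp add: mult.commute)
  qed
  \<comment> \<open>Otherwise \<open>f\<close> lies in the kernel, so all of \<open>c\<close>
    vanishes.\<close>
  have "c None \<noteq> 0"
  proof
    assume 0: "c None = 0"
    then have "\<forall>x\<in>S. L f x = 0" using Lf by simp
    then have "\<forall>x. f x = 0" using ker[of f] f_eq by simp
    then have "\<forall>x\<in>S. c (Some x) = 0" by (metis f_eq)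
    with c 0 show False by auto
  qed
  then have "\<forall>x\<in>S. L (\<lambda>y. (1 / c None) * f y) x = b x"
    using scale[of _ "1 / c None" f] Lf by simp
  then show "\<exists>f. (\<forall>x. x \<notin> S \<longrightarrow> f x = 0) \<and> (\<forall>x\<in>S. L f x = b x)"
    using f_eq by (intro exI[of _ "\<lambda>y. (1 / c None) * f y"]) simp
next
  fix f g
  assume f: "(\<forall>x. x \<notin> S \<longrightarrow> f x = 0) \<and> (\<forall>x\<in>S. L f x = b x)"
    and g: "(\<forall>x. x \<notin> S \<longrightarrow> g x = 0) \<and> (\<forall>x\<in>S. L g x = b x)"
  have "\<forall>x\<in>S. L (\<lambda>y. f y + (-1) * g y) x = 0"
    using f g add[of _ f "\<lambda>y. (-1) * g y"] scale[of _ "-1" g] by simp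
  then have "\<forall>x. f x + (-1) * g x = 0"
    using ker[of "\<lambda>y. f y + (-1) * g y"] f g by simp
  then show "f = g" by auto
qed


section \<open>The grid\<close>

text \<open>\<open>S\<close> need not be invariant under the shift: on both sides only pairs of
  neighbours lying in \<open>S\<close> contribute, and the shift is a bijection between them. This
  is the common source of all summations by parts below.\<close>

lemma sum_shift_product:
  fixes a b :: "'a::ab_group_add \<Rightarrow> real"
  assumes "finite S" "\<forall>x. x \<notin> S \<longrightarrow> a x = 0" "\<forall>x. x \<notin> S \<longrightarrow> b x = 0"
  shows "(\<Sum>x\<in>S. a (x - e) * b x) = (\<Sum>x\<in>S. a x * b (x + e))"
proof -
  have "(\<Sum>x\<in>S. a (x - e) * b x) = (\<Sum>x\<in>{x\<in>S. x - e \<in> S}. a (x - e) * b x)"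
    using assms by (intro sum.mono_neutral_right) auto
  also have "\<dots> = (\<Sum>x\<in>{x\<in>S. x + e \<in> S}. a x * b (x + e))"
    by (rule sum.reindex_bij_witness[of _ "\<lambda>x. x + e" "\<lambda>x. x - e"]) auto
  also have "\<dots> = (\<Sum>x\<in>S. a x * b (x + e))"
    using assms by (intro sum.mono_neutral_left) auto
  finally show ?thesis .
qed

text \<open>The integer coordinates are bounded by \<open>m\<close>, so every point comes from one
  of finitely many integer triples.\<close>

lemma finite_bounded_scaled_lattice:
  assumes "bounded \<Omega>" "h > 0"
  shows "finite (\<Omega> \<inter> scaled_lattice h)"
proof -
  obtain B where B: "\<And>x. x \<in> \<Omega> \<Longrightarrow> norm x \<le> B" using assms(1) bounded_iff by blast
  define m where "m = \<lceil>B / h\<rceil>"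
  have "\<Omega> \<inter> scaled_lattice h \<subseteq> (\<lambda>k. \<chi> i. h * of_int (k i)) ` (UNIV \<rightarrow>\<^sub>E {-m..m})"
  proof
    fix x assume x: "x \<in> \<Omega> \<inter> scaled_lattice h"
    then obtain k where k: "\<And>i. x $ i = h * of_int (k i)"
      unfolding scaled_lattice_def by (auto, metis)
    have "\<bar>k i\<bar> \<le> m" for i
    proof -
      have "h * \<bar>of_int (k i)\<bar> \<le> B"
        using component_le_norm_cart[of x i] B[of x] x k[of i] assms(2) by (simp add: abs_mult)
      then have "of_int \<bar>k i\<bar> \<le> B / h" using assms(2) by (simp add: field_simps)
      then show ?thesis unfolding m_def by linarith
    qed
    then have "k \<in> UNIV \<rightarrow>\<^sub>E {-m..m}" by (simp add: PiE_UNIV_domain Pi_def abs_le_iff minus_le_iff)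
    moreover have "x = (\<chi> i. h * of_int (k i))" using k by (simp add: vec_eq_iff)
    ultimately show "x \<in> (\<lambda>k. \<chi> i. h * of_int (k i)) ` (UNIV \<rightarrow>\<^sub>E {-m..m})" by blast
  qed
  moreover have "finite ((\<lambda>k. \<chi> i. h * of_int (k i) :: real^3) ` (UNIV \<rightarrow>\<^sub>E {-m..m}))"
    by (intro finite_imageI finite_PiE) auto
  ultimately show ?thesis by (rule finite_subset)
qed

lemma finite_grid: "bounded \<Omega> \<Longrightarrow> h > 0 \<Longrightarrow> finite (grid \<Omega> h)"
  by (rule finite_subset[OF _ finite_bounded_scaled_lattice[of \<Omega> h]]) (auto simp: grid_def)

lemma grid_interior_subset: "grid_interior h A \<subseteq> A"
  by (auto simp: grid_interior_def)

lemma grid_boundary_eq: "grid_boundary h A = A - grid_interior h A"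
  by (auto simp: grid_interior_def grid_boundary_def)

text \<open>Extension by zero and the boundary condition merge into one support condition, the one
  under which \<open>trivial_kernel_imp_uniquely_solvable\<close> counts unknowns.\<close>

lemma grid_fun_zero_on_boundary_iff:
  fixes f :: "real^3 \<Rightarrow> 'b::zero"
  shows "f \<in> grid_fun A \<and> (\<forall>x\<in>grid_boundary h A. f x = 0) \<longleftrightarrow> (\<forall>x. x \<notin> grid_interior h A \<longrightarrow> f x = 0)"
  using grid_interior_subset[of h A] unfolding grid_fun_def grid_boundary_eq by auto


section \<open>The discrete Helmholtz--Hodge decomposition\<close>

text \<open>The cut-off matters because \<open>grad_plus h \<phi>\<close> may be nonzero at boundary
  points next to the interior, where the projected field has to vanish.\<close>

definition masked :: "'a set \<Rightarrow> ('a \<Rightarrow> real^3) \<Rightarrow> 'a \<Rightarrow> real^3" where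
  "masked S q x = (if x \<in> S then q x else 0)"

text \<open>The backward divergence is minus the adjoint of the forward gradient. No boundary terms
  appear, since both \<open>\<phi>\<close> and the masked field vanish off \<open>S\<close>.\<close>

lemma div_minus_grad_plus_by_parts:
  assumes "finite S" "\<forall>x. x \<notin> S \<longrightarrow> \<phi> x = 0"
  shows "(\<Sum>x\<in>S. \<phi> x * div_minus h (masked S q) x) = - (\<Sum>x\<in>S. q x \<bullet> grad_plus h \<phi> x)"
proof -
  have "(\<Sum>x\<in>S. \<phi> x * Dminus h i (\<lambda>y. masked S q y $ i) x) = - (\<Sum>x\<in>S. q x $ i * Dplus h i \<phi> x)" for i
  proof -
    define a where "a y = masked S q y $ i" for y
    have a0: "\<forall>x. x \<notin> S \<longrightarrow> a x = 0" by (simp add: a_def masked_def)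
    have "\<phi> x * Dminus h i a x = (a x * \<phi> x - a (x - h *\<^sub>R axis i 1) * \<phi> x) / h" for x
      by (simp add: Dminus_def right_diff_distrib mult.commute)
    then have "(\<Sum>x\<in>S. \<phi> x * Dminus h i a x)
        = ((\<Sum>x\<in>S. a x * \<phi> x) - (\<Sum>x\<in>S. a (x - h *\<^sub>R axis i 1) * \<phi> x)) / h"
      by (simp only: sum_divide_distrib[symmetric] sum_subtractf)
    also have "\<dots> = ((\<Sum>x\<in>S. a x * \<phi> x) - (\<Sum>x\<in>S. a x * \<phi> (x + h *\<^sub>R axis i 1))) / h"
      using sum_shift_product[OF assms(1) a0 assms(2)] by simp
    also have "\<dots> = - (\<Sum>x\<in>S. a x * Dplus h i \<phi> x)"
      by (simp add: Dplus_def right_diff_distrib sum_subtractf sum_divide_distrib[symmetric]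
          minus_divide_left)
    also have "(\<Sum>x\<in>S. a x * Dplus h i \<phi> x) = (\<Sum>x\<in>S. q x $ i * Dplus h i \<phi> x)"
      by (rule sum.cong) (simp_all add: a_def masked_def)
    finally show ?thesis by (simp add: a_def[abs_def])
  qed
  then have "(\<Sum>i\<in>UNIV. \<Sum>x\<in>S. \<phi> x * Dminus h i (\<lambda>y. masked S q y $ i) x)
      = - (\<Sum>i\<in>UNIV. \<Sum>x\<in>S. q x $ i * Dplus h i \<phi> x)"
    by (simp add: sum_negf)
  then show ?thesis
    unfolding div_minus_def inner_vec_def grad_plus_def sum_distrib_left
    by (subst (1 2) sum.swap) simp
qed

text \<open>A point of the support with maximal first coordinate would have its right neighbour in
  the support as well.\<close>

lemma grad_plus_zero_imp_zero:
  assumes fin: "finite A" and h: "h > 0"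
    and supp: "\<forall>x. x \<notin> grid_interior h A \<longrightarrow> \<phi> x = 0"
    and grad: "\<forall>x\<in>grid_interior h A. grad_plus h \<phi> x = 0"
  shows "\<phi> x = 0"
proof (rule ccontr)
  assume "\<phi> x \<noteq> 0"
  define P where "P = {x. \<phi> x \<noteq> 0}"
  have "P \<subseteq> grid_interior h A" using supp by (auto simp: P_def)
  then have "finite P" using fin grid_interior_subset finite_subset by metis
  moreover have "P \<noteq> {}" using \<open>\<phi> x \<noteq> 0\<close> by (auto simp: P_def)
  ultimately obtain y where y: "y \<in> P" "\<forall>z\<in>P. z $ 1 \<le> y $ 1"
    using Max_in[of "(\<lambda>z. z $ 1) ` P"] Max_ge[of "(\<lambda>z. z $ 1) ` P"] by fastforce
  then have "grad_plus h \<phi> y $ 1 = 0" using grad \<open>P \<subseteq> grid_interior h A\<close> by auto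
  then have "\<phi> (y + h *\<^sub>R axis 1 1) = \<phi> y" using h by (simp add: grad_plus_def Dplus_def)
  then have "y + h *\<^sub>R axis 1 1 \<in> P" using y by (simp add: P_def)
  then show False using y(2) h by fastforce
qed

section \<open>Linearity of the difference operators\<close>

lemma Dplus_add: "Dplus h j (\<lambda>y. a y + b y) x = Dplus h j a x + Dplus h j b x"
  unfolding Dplus_def add_divide_distrib[symmetric] by (rule arg_cong[of _ _ "\<lambda>t. t / h"]) simp

lemma Dplus_scale: "Dplus h j (\<lambda>y. c * a y) x = c * Dplus h j a x"
  by (simp add: Dplus_def right_diff_distrib)

lemma Dminus_add: "Dminus h j (\<lambda>y. a y + b y) x = Dminus h j a x + Dminus h j b x"
  unfolding Dminus_def add_divide_distrib[symmetric] by (rule arg_cong[of _ _ "\<lambda>t. t / h"]) simp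

lemma Dminus_scale: "Dminus h j (\<lambda>y. c * a y) x = c * Dminus h j a x"
  by (simp add: Dminus_def right_diff_distrib)

lemma div_minus_add: "div_minus h (\<lambda>y. a y + b y) x = div_minus h a x + div_minus h b x"
  by (simp add: div_minus_def Dminus_add sum.distrib)

lemma div_minus_scale: "div_minus h (\<lambda>y. c *\<^sub>R a y) x = c * div_minus h a x"
  by (simp add: div_minus_def Dminus_scale sum_distrib_left)

lemma grad_plus_add: "grad_plus h (\<lambda>y. a y + b y) x = grad_plus h a x + grad_plus h b x"
  by (simp add: grad_plus_def Dplus_add vec_eq_iff)

lemma grad_plus_scale: "grad_plus h (\<lambda>y. c * a y) x = c *\<^sub>R grad_plus h a x"
  by (simp add: grad_plus_def Dplus_scale vec_eq_iff)

lemma masked_add: "masked S (\<lambda>y. a y + b y) = (\<lambda>y. masked S a y + masked S b y)"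
  by (auto simp: masked_def)

lemma masked_scale: "masked S (\<lambda>y. c *\<^sub>R a y) = (\<lambda>y. c *\<^sub>R masked S a y)"
  by (auto simp: masked_def)

text \<open>Pairing a kernel element with its own equation turns the masked Laplacian into a sum of
  squared gradients.\<close>

lemma discrete_poisson_uniquely_solvable:
  assumes fin: "finite A" and h: "h > 0"
  defines "S \<equiv> grid_interior h A"
  shows "\<exists>!\<phi>. (\<forall>x. x \<notin> S \<longrightarrow> \<phi> x = 0) \<and> (\<forall>x\<in>S. div_minus h (masked S (grad_plus h \<phi>)) x = b x)"
proof (rule trivial_kernel_imp_uniquely_solvable)
  show finS: "finite S"
    using fin grid_interior_subset finite_subset unfolding S_def by metis
  show "div_minus h (masked S (grad_plus h (\<lambda>y. f y + g y))) x =
      div_minus h (masked S (grad_plus h f)) x + div_minus h (masked S (grad_plus h g)) x" for f g x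
    unfolding grad_plus_add[abs_def] masked_add div_minus_add ..
  show "div_minus h (masked S (grad_plus h (\<lambda>y. c * f y))) x =
      c * div_minus h (masked S (grad_plus h f)) x" for c f x
    unfolding grad_plus_scale[abs_def] masked_scale div_minus_scale ..
  fix f assume f0: "\<forall>x. x \<notin> S \<longrightarrow> f x = 0"
    and div0: "\<forall>x\<in>S. div_minus h (masked S (grad_plus h f)) x = 0"
  have "(\<Sum>x\<in>S. grad_plus h f x \<bullet> grad_plus h f x) = 0"
    using div_minus_grad_plus_by_parts[OF finS f0, of h "grad_plus h f"] div0 by simp
  then have "\<forall>x\<in>S. grad_plus h f x = 0"
    using finS by (subst (asm) sum_nonneg_eq_0_iff) auto
  then show "\<forall>x. f x = 0"
    using grad_plus_zero_imp_zero[OF fin h] f0 unfolding S_def by blast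
qed

text \<open>The decomposition forces \<open>w\<close> to be \<open>u\<close> minus the gradient on
  the interior and zero elsewhere. Inserting this into the divergence constraint leaves an equation
  for \<open>\<phi>\<close> alone, the one solved by
  \<open>discrete_poisson_uniquely_solvable\<close>.\<close>

lemma is_helmholtz_decomp_iff:
  defines "S \<equiv> \<lambda>\<Omega> h. grid_interior h (grid \<Omega> h)"
  shows "is_helmholtz_decomp \<Omega> h u w \<phi> \<longleftrightarrow>
    (\<forall>x. x \<notin> S \<Omega> h \<longrightarrow> \<phi> x = 0) \<and>
    (\<forall>x\<in>S \<Omega> h. div_minus h (masked (S \<Omega> h) (grad_plus h \<phi>)) x = div_minus h (masked (S \<Omega> h) u) x) \<and>
    w = masked (S \<Omega> h) (\<lambda>x. u x - grad_plus h \<phi> x)"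
proof -
  let ?S = "S \<Omega> h"
  have "is_helmholtz_decomp \<Omega> h u w \<phi> \<longleftrightarrow>
      (\<forall>x. x \<notin> ?S \<longrightarrow> \<phi> x = 0) \<and> (\<forall>x. x \<notin> ?S \<longrightarrow> w x = 0) \<and>
      (\<forall>x\<in>?S. div_minus h w x = 0) \<and> (\<forall>x\<in>?S. w x + grad_plus h \<phi> x = u x)"
    unfolding is_helmholtz_decomp_def S_def grid_fun_zero_on_boundary_iff[symmetric] by blast
  also have "\<dots> \<longleftrightarrow> (\<forall>x. x \<notin> ?S \<longrightarrow> \<phi> x = 0) \<and> (\<forall>x\<in>?S. div_minus h w x = 0) \<and>
      w = masked ?S (\<lambda>x. u x - grad_plus h \<phi> x)"
    by (auto simp: masked_def fun_eq_iff algebra_simps)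
  also have "\<dots> \<longleftrightarrow> (\<forall>x. x \<notin> ?S \<longrightarrow> \<phi> x = 0) \<and>
      (\<forall>x\<in>?S. div_minus h (masked ?S (grad_plus h \<phi>)) x = div_minus h (masked ?S u) x) \<and>
      w = masked ?S (\<lambda>x. u x - grad_plus h \<phi> x)"
  proof -
    have "masked ?S u = (\<lambda>x. masked ?S (\<lambda>x. u x - grad_plus h \<phi> x) x + masked ?S (grad_plus h \<phi>) x)"
      unfolding masked_add[symmetric] by simp
    then have "div_minus h (masked ?S u) x =
        div_minus h (masked ?S (\<lambda>x. u x - grad_plus h \<phi> x)) x + div_minus h (masked ?S (grad_plus h \<phi>)) x" for x
      by (simp only: div_minus_add)
    then show ?thesis by auto
  qed
  finally show ?thesis .
qed

lemma helmholtz_proj_div_free: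
  assumes "bounded \<Omega>" "h > 0" "x \<in> grid_interior h (grid \<Omega> h)"
  shows "div_minus h (helmholtz_proj \<Omega> h u) x = 0"
proof -
  let ?S = "grid_interior h (grid \<Omega> h)"
  \<comment> \<open>\<open>\<phi>\<close> is unique and determines \<open>w\<close>; so the
    \<open>THE\<close> in \<open>helmholtz_proj\<close> denotes an actual decomposition.\<close>
  have "\<exists>!p. case p of (w, \<phi>) \<Rightarrow> is_helmholtz_decomp \<Omega> h u w \<phi>"
    using discrete_poisson_uniquely_solvable[OF finite_grid[OF assms(1,2)] assms(2),
        of "div_minus h (masked ?S u)"]
    unfolding is_helmholtz_decomp_iff by auto
  then have "case (THE p. case p of (w, \<phi>) \<Rightarrow> is_helmholtz_decomp \<Omega> h u w \<phi>) of
      (w, \<phi>) \<Rightarrow> is_helmholtz_decomp \<Omega> h u w \<phi>"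
    by (rule theI')
  then have "\<exists>\<phi>. is_helmholtz_decomp \<Omega> h u (helmholtz_proj \<Omega> h u) \<phi>"
    unfolding helmholtz_proj_def by (auto split: prod.splits)
  then show ?thesis using assms(3) by (auto simp: is_helmholtz_decomp_def)
qed


section \<open>One step of the implicit scheme\<close>

definition transport :: "real \<Rightarrow> (real^3 \<Rightarrow> real^3) \<Rightarrow> (real^3 \<Rightarrow> real) \<Rightarrow> real^3 \<Rightarrow> real" where
  "transport h w f x = 1 / 2 * (\<Sum>j\<in>UNIV.
      w (x - h *\<^sub>R axis j 1) $ j * Dplus h j f (x - h *\<^sub>R axis j 1) + w x $ j * Dplus h j f x)"

lemma transport_add: "transport h w (\<lambda>y. f y + g y) x = transport h w f x + transport h w g x"
  unfolding transport_def Dplus_add distrib_left sum.distrib by simp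

lemma transport_scale: "transport h w (\<lambda>y. c * f y) x = c * transport h w f x"
  unfolding transport_def Dplus_scale sum_distrib_left by (simp add: algebra_simps)

text \<open>Up to telescoping terms, \<open>f\<close> times its transport is \<open>- f\<^sup>2 / 2\<close> times the divergence.\<close>

lemma transport_skew:
  assumes "finite S" "\<forall>x. x \<notin> S \<longrightarrow> f x = 0" "\<forall>x\<in>S. div_minus h w x = 0"
  shows "(\<Sum>x\<in>S. f x * transport h w f x) = 0"
proof -
  define e where "e j = h *\<^sub>R (axis j 1 :: real^3)" for j
  define F where "F j x = w (x - e j) $ j * f (x - e j) * f x" for j x
  define G where "G j x = w x $ j * f x * f (x + e j)" for j x
  \<comment> \<open>\<open>F j\<close> is \<open>G j\<close> shifted by one cell. The zero values
    off \<open>S\<close> come from the factor \<open>f\<close>, not from \<open>w\<close>.\<close>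
  have tele: "(\<Sum>x\<in>S. F j x) = (\<Sum>x\<in>S. G j x)" for j
    unfolding F_def G_def using assms
    by (intro sum_shift_product[of S "\<lambda>x. w x $ j * f x" f "e j"]) auto
  \<comment> \<open>The mixed products form \<open>G\<close> and \<open>F\<close>; the two terms
    with the square of \<open>f x\<close> combine to the backward difference of
    \<open>w\<close>.\<close>
  have pt: "f x * (w (x - e j) $ j * Dplus h j f (x - e j) + w x $ j * Dplus h j f x)
      = (G j x - F j x) / h - (f x)\<^sup>2 * Dminus h j (\<lambda>y. w y $ j) x" for j x
    by (simp add: Dplus_def Dminus_def F_def G_def e_def power2_eq_square
        diff_divide_distrib add_divide_distrib algebra_simps)
  have "f x * transport h w f x
      = 1 / 2 * ((\<Sum>j\<in>UNIV. (G j x - F j x) / h) - (f x)\<^sup>2 * div_minus h w x)" for x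
  proof -
    have "f x * transport h w f x = 1 / 2 * (\<Sum>j\<in>UNIV.
        f x * (w (x - e j) $ j * Dplus h j f (x - e j) + w x $ j * Dplus h j f x))"
      by (simp add: transport_def e_def sum_distrib_left)
    also have "\<dots> = 1 / 2 * ((\<Sum>j\<in>UNIV. (G j x - F j x) / h) - (f x)\<^sup>2 * div_minus h w x)"
      unfolding pt by (simp add: div_minus_def sum_subtractf sum_distrib_left)
    finally show ?thesis .
  qed
  then have "(\<Sum>x\<in>S. f x * transport h w f x) = (\<Sum>x\<in>S. 1 / 2 * (\<Sum>j\<in>UNIV. (G j x - F j x) / h))"
    using assms(3) by (intro sum.cong) auto
  also have "\<dots> = 1 / 2 * (\<Sum>j\<in>UNIV. (\<Sum>x\<in>S. G j x - F j x) / h)"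
    by (simp only: sum_distrib_left[symmetric] sum.swap[of _ UNIV S] sum_divide_distrib)
  also have "\<dots> = 0" by (simp add: sum_subtractf tele)
  finally show ?thesis .
qed

lemma implicit_step_energy:
  fixes f g :: "real^3 \<Rightarrow> real"
  assumes "finite S" "\<tau> > 0" "\<forall>x. x \<notin> S \<longrightarrow> f x = 0" "\<forall>x\<in>S. div_minus h w x = 0"
    and "\<forall>x\<in>S. (f x - g x) / \<tau> + transport h w f x = 0"
  shows "(\<Sum>x\<in>S. (f x)\<^sup>2) \<le> (\<Sum>x\<in>S. (g x)\<^sup>2)"
proof -
  have "f x * (f x - g x) = - \<tau> * (f x * transport h w f x)" if "x \<in> S" for x
  proof -
    have "(f x - g x) / \<tau> = - transport h w f x" using assms(5) that by (simp add: eq_neg_iff_add_eq_0)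
    then have "f x - g x = - \<tau> * transport h w f x" using assms(2) by (simp add: field_simps)
    then show ?thesis by simp
  qed
  then have "(\<Sum>x\<in>S. f x * (f x - g x)) = - \<tau> * (\<Sum>x\<in>S. f x * transport h w f x)"
    unfolding sum_distrib_left by (rule sum.cong[OF refl])
  then have 0: "(\<Sum>x\<in>S. f x * (f x - g x)) = 0"
    using transport_skew[OF assms(1,3,4)] by simp
  \<comment> \<open>The difference of the two sides is the square of \<open>f x - g x\<close>, the
    numerical dissipation of the implicit step.\<close>
  have "(f x)\<^sup>2 - (g x)\<^sup>2 \<le> 2 * (f x * (f x - g x))" for x
    using zero_le_power2[of "f x - g x"] by (simp add: power2_eq_square algebra_simps)
  then have "(\<Sum>x\<in>S. (f x)\<^sup>2 - (g x)\<^sup>2) \<le> (\<Sum>x\<in>S. 2 * (f x * (f x - g x)))"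
    by (rule sum_mono)
  also have "\<dots> = 0" using 0 by (simp only: sum_distrib_left[symmetric])
  finally show ?thesis by (simp add: sum_subtractf)
qed

text \<open>The energy inequality with previous level zero shows that the kernel is trivial, with no
  restriction on the ratio of \<open>\<tau>\<close> to \<open>h\<close>.\<close>

lemma implicit_step_uniquely_solvable:
  fixes g :: "real^3 \<Rightarrow> real"
  assumes "finite S" "\<tau> > 0" "\<forall>x\<in>S. div_minus h w x = 0"
  shows "\<exists>!f. (\<forall>x. x \<notin> S \<longrightarrow> f x = 0) \<and> (\<forall>x\<in>S. (f x - g x) / \<tau> + transport h w f x = 0)"
proof -
  have "\<exists>!f. (\<forall>x. x \<notin> S \<longrightarrow> f x = 0) \<and> (\<forall>x\<in>S. f x / \<tau> + transport h w f x = g x / \<tau>)"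
  proof (rule trivial_kernel_imp_uniquely_solvable[OF assms(1)])
    fix f :: "real^3 \<Rightarrow> real"
    assume f: "\<forall>x. x \<notin> S \<longrightarrow> f x = 0" "\<forall>x\<in>S. f x / \<tau> + transport h w f x = 0"
    then have "(\<Sum>x\<in>S. (f x)\<^sup>2) \<le> 0"
      using implicit_step_energy[OF assms(1,2) f(1) assms(3), of "\<lambda>_. 0"] by simp
    then have "(\<Sum>x\<in>S. (f x)\<^sup>2) = 0" by (intro antisym sum_nonneg) auto
    then show "\<forall>x. f x = 0" using assms(1) f(1) by (auto simp: sum_nonneg_eq_0_iff)
  qed (simp_all add: transport_add transport_scale add_divide_distrib distrib_left)
  moreover have "(f x - g x) / \<tau> + transport h w f x = 0 \<longleftrightarrow> f x / \<tau> + transport h w f x = g x / \<tau>" for f x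
    by (auto simp: diff_divide_distrib)
  ultimately show ?thesis by simp
qed

section \<open>The scheme over all time levels\<close>

text \<open>Each level becomes a system of the form treated above. Membership in
  \<open>extensional\<close> fixes the values beyond \<open>N\<close>, which uniqueness of
  \<open>g\<close> as a function of all natural numbers requires.\<close>

lemma solves_scheme_iff:
  "solves_scheme \<Omega> h \<tau> N w g0 g \<longleftrightarrow>
     g \<in> extensional {0..N} \<and> g 0 = g0 \<and> g0 \<in> grid_fun (grid \<Omega> h) \<and>
     (\<forall>n<N. (\<forall>x. x \<notin> grid_interior h (grid \<Omega> h) \<longrightarrow> g (Suc n) x = 0) \<and>
        (\<forall>x\<in>grid_interior h (grid \<Omega> h).
           (g (Suc n) x - g n x) / \<tau> + transport h (w n) (g (Suc n)) x = 0))"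
proof -
  have "g \<in> {0..N} \<rightarrow>\<^sub>E grid_fun (grid \<Omega> h) \<longleftrightarrow> g \<in> extensional {0..N} \<and>
      g 0 \<in> grid_fun (grid \<Omega> h) \<and> (\<forall>n<N. g (Suc n) \<in> grid_fun (grid \<Omega> h))"
  proof -
    have "{0..N} = insert 0 (Suc ` {..<N})"
      by (simp add: atLeast0AtMost lessThan_Suc_atMost[symmetric] lessThan_Suc_eq_insert_0)
    then have "g \<in> {0..N} \<rightarrow> F \<longleftrightarrow> g 0 \<in> F \<and> (\<forall>n<N. g (Suc n) \<in> F)" for F
      by (auto simp: Pi_def)
    then show ?thesis unfolding PiE_def by blast
  qed
  then show ?thesis
    unfolding solves_scheme_def transport_def grid_fun_zero_on_boundary_iff[symmetric] by blast
qed

lemma solves_scheme_ex1: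
  assumes "bounded \<Omega>" "h > 0" "\<tau> > 0" "g0 \<in> grid_fun (grid \<Omega> h)"
    and div: "\<forall>n<N. \<forall>x\<in>grid_interior h (grid \<Omega> h). div_minus h (w n) x = 0"
  shows "\<exists>!g. solves_scheme \<Omega> h \<tau> N w g0 g"
proof (rule ex_ex1I)
  let ?S = "grid_interior h (grid \<Omega> h)"
  define step where "step n g f \<longleftrightarrow> (\<forall>x. x \<notin> ?S \<longrightarrow> f x = 0) \<and>
      (\<forall>x\<in>?S. (f x - g x) / \<tau> + transport h (w n) f x = 0)" for n g f
  have ex1: "\<exists>!f. step n g f" if "n < N" for n g
    unfolding step_def using finite_subset[OF grid_interior_subset finite_grid[OF assms(1,2)]] div that
    by (intro implicit_step_uniquely_solvable assms(3)) auto
  have iff: "solves_scheme \<Omega> h \<tau> N w g0 g \<longleftrightarrow>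
      g \<in> extensional {0..N} \<and> g 0 = g0 \<and> (\<forall>n<N. step n (g n) (g (Suc n)))" for g
    using assms(4) by (simp add: solves_scheme_iff step_def)
  \<comment> \<open>Beyond level \<open>N\<close> the \<open>THE\<close> may be unspecified;
    \<open>restrict\<close> removes those levels.\<close>
  define G where "G = rec_nat g0 (\<lambda>n g. THE f. step n g f)"
  have "step n (G n) (G (Suc n))" if "n < N" for n
    using theI'[OF ex1[OF that, of "G n"]] by (simp add: G_def)
  then show "\<exists>g. solves_scheme \<Omega> h \<tau> N w g0 g"
    unfolding iff by (intro exI[of _ "restrict G {0..N}"]) (auto simp: G_def)
  fix g g' assume g: "solves_scheme \<Omega> h \<tau> N w g0 g" and g': "solves_scheme \<Omega> h \<tau> N w g0 g'"
  have "n \<le> N \<Longrightarrow> g n = g' n" for n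
  proof (induction n)
    case 0
    then show ?case using g g' by (simp add: iff)
  next
    case (Suc n)
    then have "step n (g n) (g (Suc n))" "step n (g n) (g' (Suc n))"
      using g g' unfolding iff by (metis Suc_le_lessD Suc_leD)+
    then show ?case using ex1[of n "g n"] Suc.prems by auto
  qed
  then show "g = g'" using g g' unfolding iff by (intro extensionalityI[of _ "{0..N}"]) auto
qed

lemma solves_scheme_norm_le:
  assumes "bounded \<Omega>" "h > 0" "\<tau> > 0"
    and div: "\<forall>n<N. \<forall>x\<in>grid_interior h (grid \<Omega> h). div_minus h (w n) x = 0"
    and g: "solves_scheme \<Omega> h \<tau> N w g0 g" and "n \<le> N"
  shows "grid_norm h (grid \<Omega> h) (g n) \<le> grid_norm h (grid \<Omega> h) g0"
  using \<open>n \<le> N\<close>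
proof (induction n)
  case 0
  then show ?case using g by (simp add: solves_scheme_iff)
next
  case (Suc n)
  let ?A = "grid \<Omega> h" and ?S = "grid_interior h (grid \<Omega> h)"
  have finA: "finite ?A" using assms finite_grid by blast
  have finS: "finite ?S" using finite_subset[OF grid_interior_subset finA] .
  have g0: "\<forall>x. x \<notin> ?S \<longrightarrow> g (Suc n) x = 0"
    and eq: "\<forall>x\<in>?S. (g (Suc n) x - g n x) / \<tau> + transport h (w n) (g (Suc n)) x = 0"
    using g Suc.prems by (auto simp: solves_scheme_iff)
  have "(\<Sum>x\<in>?A. (g (Suc n) x)\<^sup>2) = (\<Sum>x\<in>?S. (g (Suc n) x)\<^sup>2)"
    using finA g0 grid_interior_subset by (intro sum.mono_neutral_right) auto
  also have "\<dots> \<le> (\<Sum>x\<in>?S. (g n x)\<^sup>2)"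
    using implicit_step_energy[OF finS assms(3) g0 _ eq] div Suc.prems by auto
  \<comment> \<open>The step sees the previous level only on the interior; passing to the whole grid
    adds squares.\<close>
  also have "\<dots> \<le> (\<Sum>x\<in>?A. (g n x)\<^sup>2)"
    using finA grid_interior_subset by (intro sum_mono2) auto
  finally have "grid_norm h ?A (g (Suc n)) \<le> grid_norm h ?A (g n)"
    using assms(2) by (simp add: grid_norm_def sum_distrib_right[symmetric] mult_right_mono)
  then show ?case using Suc by simp
qed


section \<open>Cell averages\<close>

lemma cube_subset_cbox: "cube h x \<subseteq> cbox (\<chi> i. x $ i - h / 2) (\<chi> i. x $ i + h / 2)"
  by (auto simp: cube_def mem_box_cart less_imp_le)

lemma cube_measurable: "cube h x \<in> sets lebesgue"
proof -
  have "cube h x = (\<Inter>i. {y. x $ i - h / 2 \<le> y $ i} \<inter> {y. y $ i < x $ i + h / 2})"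
    by (auto simp: cube_def)
  moreover have "\<dots> \<in> sets borel"
    by (intro sets.finite_INT) auto
  ultimately show ?thesis by simp
qed

lemma emeasure_cube_le:
  assumes "h > 0"
  shows "emeasure lebesgue (cube h x) \<le> ennreal (h ^ 3)"
proof -
  let ?a = "\<chi> i. x $ i - h / 2" and ?b = "\<chi> i. x $ i + h / 2"
  have "emeasure lebesgue (cube h x) \<le> emeasure lebesgue (cbox ?a ?b)"
    by (intro emeasure_mono cube_subset_cbox) auto
  also have "\<dots> = ennreal (measure lborel (cbox ?a ?b))"
    using emeasure_lborel_cbox_finite[of ?a ?b] by (simp add: emeasure_eq_ennreal_measure)
  also have "measure lborel (cbox ?a ?b) = h ^ 3"
    using assms by (subst content_cbox_cart) (auto simp: interval_eq_empty_cart)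
  finally show ?thesis .
qed

text \<open>Since the cubes are half-open, two centres sharing a point differ by strictly less than
  \<open>h\<close> in each coordinate, so their integer coordinates agree.\<close>

lemma disjoint_cubes:
  assumes "h > 0" "x \<in> scaled_lattice h" "x' \<in> scaled_lattice h" "y \<in> cube h x" "y \<in> cube h x'"
  shows "x = x'"
proof -
  have "x $ i = x' $ i" for i
  proof -
    obtain k k' :: int where k: "x $ i = h * of_int k" "x' $ i = h * of_int k'"
      using assms(2,3) unfolding scaled_lattice_def by blast
    have "\<bar>x $ i - x' $ i\<bar> < h"
      using assms(4,5) unfolding cube_def by (auto simp: abs_less_iff dest!: spec[of _ i])
    then have "h * \<bar>of_int k - of_int k'\<bar> < h * 1"
      using assms(1) by (simp add: k right_diff_distrib[symmetric] abs_mult)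
    then have "\<bar>of_int k - of_int k'\<bar> < (1::real)" using assms(1) by (simp only: mult_less_cancel_left_pos)
    then have "k = k'" by linarith
    then show ?thesis using k by simp
  qed
  then show ?thesis by (simp add: vec_eq_iff)
qed

text \<open>If \<open>f\<close> is not integrable, its Bochner integral is \<open>0\<close> and the claim is trivial.\<close>

lemma square_average_le:
  fixes f :: "'a \<Rightarrow> real"
  assumes M: "emeasure M (space M) \<le> ennreal V" and "V > 0"
    and f2: "integrable M (\<lambda>y. (f y)\<^sup>2)"
  shows "(1 / V * (\<integral>y. f y \<partial>M))\<^sup>2 * V \<le> (\<integral>y. (f y)\<^sup>2 \<partial>M)"
proof (cases "integrable M f")
  case False
  then show ?thesis by (simp add: not_integrable_integral_eq)
next
  case True
  \<comment> \<open>The mean is normalised by the bound \<open>V\<close> rather than by the measure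
    of the space. Expanding the integral of the square of \<open>f y - m\<close> still gives the
    claim, because that measure is at most \<open>V\<close>.\<close>
  define m where "m = 1 / V * (\<integral>y. f y \<partial>M)"
  interpret finite_measure M
    using M by (intro finite_measureI) (auto simp: top_unique)
  have "measure M (space M) \<le> V"
    using M \<open>V > 0\<close> by (simp add: emeasure_eq_measure)
  then have "m\<^sup>2 * measure M (space M) \<le> m\<^sup>2 * V" by (intro mult_left_mono) auto
  moreover have "0 \<le> (\<integral>y. (f y - m)\<^sup>2 \<partial>M)" by simp
  moreover have "(\<integral>y. (f y - m)\<^sup>2 \<partial>M) = (\<integral>y. (f y)\<^sup>2 - 2 * m * f y + m\<^sup>2 \<partial>M)"
    by (simp add: power2_diff algebra_simps)
  moreover have "\<dots> = (\<integral>y. (f y)\<^sup>2 \<partial>M) - 2 * m * (\<integral>y. f y \<partial>M) + m\<^sup>2 * measure M (space M)"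
    using True f2 by simp
  moreover have "(\<integral>y. f y \<partial>M) = m * V" using \<open>V > 0\<close> by (simp add: m_def)
  ultimately have "m\<^sup>2 * V \<le> (\<integral>y. (f y)\<^sup>2 \<partial>M)" by (simp add: power2_eq_square algebra_simps)
  then show ?thesis by (simp add: m_def)
qed

lemma grid_norm_g_init_le:
  assumes "open \<Omega>" "bounded \<Omega>" "h > 0" "f \<in> L2_space \<Omega>"
  shows "grid_norm h (grid \<Omega> h) (g_init \<Omega> h f) \<le> L2_norm \<Omega> f"
proof -
  let ?A = "grid \<Omega> h"
  have \<Omega>: "\<Omega> \<in> sets lebesgue" using assms(1) by (simp add: borel_open)
  have sub: "cube h x \<subseteq> \<Omega>" if "x \<in> ?A" for x
  proof -
    have "cube h x \<subseteq> cube (2 * h) x"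
    proof
      fix y assume y: "y \<in> cube h x"
      have "x $ i - 2 * h / 2 \<le> y $ i \<and> y $ i < x $ i + 2 * h / 2" for i
      proof -
        have "x $ i - h / 2 \<le> y $ i" "y $ i < x $ i + h / 2" using y by (auto simp: cube_def)
        with assms(3) show ?thesis by simp
      qed
      then show "y \<in> cube (2 * h) x" by (simp add: cube_def)
    qed
    then show ?thesis using that unfolding grid_def by blast
  qed
  have f2: "set_integrable lebesgue \<Omega> (\<lambda>y. (f y)\<^sup>2)"
    using assms(4) \<Omega> by (simp add: L2_space_def set_integrable_def integrable_restrict_space)
  have c2: "set_integrable lebesgue (cube h x) (\<lambda>y. (f y)\<^sup>2)" if "x \<in> ?A" for x
    using set_integrable_subset[OF f2 cube_measurable sub[OF that]] .
  have "(\<Sum>x\<in>?A. \<bar>g_init \<Omega> h f x\<bar>\<^sup>2 * h ^ 3) \<le> (\<Sum>x\<in>?A. LINT y:cube h x|lebesgue. (f y)\<^sup>2)"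
  proof (rule sum_mono)
    fix x assume x: "x \<in> ?A"
    have "(1 / h ^ 3 * (\<integral>y. f y \<partial>lebesgue_on (cube h x)))\<^sup>2 * h ^ 3
        \<le> (\<integral>y. (f y)\<^sup>2 \<partial>lebesgue_on (cube h x))"
      using c2[OF x] emeasure_cube_le[OF assms(3)] assms(3) cube_measurable
      by (intro square_average_le)
        (simp_all add: emeasure_restrict_space space_restrict_space integrable_restrict_space set_integrable_def)
    then show "\<bar>g_init \<Omega> h f x\<bar>\<^sup>2 * h ^ 3 \<le> (LINT y:cube h x|lebesgue. (f y)\<^sup>2)"
      using x cube_measurable unfolding power2_abs by (simp add: g_init_def set_lebesgue_integral_def integral_restrict_space)
  qed
  also have "\<dots> = (\<integral>y. (\<Sum>x\<in>?A. indicator (cube h x) y *\<^sub>R (f y)\<^sup>2) \<partial>lebesgue)"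
    using c2 unfolding set_lebesgue_integral_def set_integrable_def
    by (intro Bochner_Integration.integral_sum[symmetric])
  also have "\<dots> \<le> (LINT y:\<Omega>|lebesgue. (f y)\<^sup>2)"
    unfolding set_lebesgue_integral_def
  proof (rule integral_mono)
    show "integrable lebesgue (\<lambda>y. \<Sum>x\<in>?A. indicator (cube h x) y *\<^sub>R (f y)\<^sup>2)"
      using c2 unfolding set_integrable_def by (intro Bochner_Integration.integrable_sum)
    show "integrable lebesgue (\<lambda>y. indicator \<Omega> y *\<^sub>R (f y)\<^sup>2)"
      using f2 unfolding set_integrable_def .
    fix y
    have disj: "disjoint_family_on (cube h) ?A"
      using disjoint_cubes[OF assms(3)] unfolding disjoint_family_on_def grid_def by blast
    have "(\<Sum>x\<in>?A. indicator (cube h x) y :: real) = indicator (\<Union>x\<in>?A. cube h x) y"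
      by (rule indicator_UN_disjoint[OF finite_grid[OF assms(2,3)] disj, symmetric])
    \<comment> \<open>The doubled cube in the definition of \<open>grid\<close> keeps every
      averaging cell inside \<open>\<Omega>\<close>.\<close>
    also have "\<dots> \<le> indicator \<Omega> y"
      using sub by (intro indicator_leI) auto
    finally show "(\<Sum>x\<in>?A. indicator (cube h x) y *\<^sub>R (f y)\<^sup>2) \<le> indicator \<Omega> y *\<^sub>R (f y)\<^sup>2"
      by (simp add: sum_distrib_right[symmetric] mult_right_mono)
  qed
  also have "\<dots> = (\<integral>y. (norm (f y))\<^sup>2 \<partial>lebesgue_on \<Omega>)"
    using \<Omega> by (simp add: set_lebesgue_integral_def integral_restrict_space)
  finally show ?thesis unfolding grid_norm_def L2_norm_def by (rule real_sqrt_le_mono)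
qed

theorem theorem4p2:
  fixes T h \<tau> :: real and N :: nat
    and \<Omega> :: "(real^3) set"
    and v :: "real \<times> (real^3) \<Rightarrow> real^3"
    and f0 :: "real^3 \<Rightarrow> real"
  assumes "T > 0"
    and "open \<Omega>" "connected \<Omega>" "bounded \<Omega>"
    and "admissible_velocity T \<Omega> v"
    and "admissible_initial \<Omega> f0"
    and "h > 0" "\<tau> > 0"
    and "T \<in> {\<tau> * real N ..< \<tau> * real N + \<tau>}"
    and "\<forall>x \<in> grid_boundary h (grid \<Omega> h). g_init \<Omega> h f0 x = 0"
    and "\<forall>n<N. \<forall>x \<in> grid_boundary h (grid \<Omega> h). u_data \<Omega> h \<tau> v n x = 0"
  shows "(\<exists>!g. solves_scheme \<Omega> h \<tau> N (w_data \<Omega> h \<tau> v) (g_init \<Omega> h f0) g) \<and>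
         (\<forall>g. solves_scheme \<Omega> h \<tau> N (w_data \<Omega> h \<tau> v) (g_init \<Omega> h f0) g \<longrightarrow>
            (\<forall>n\<le>N. grid_norm h (grid \<Omega> h) (g n) \<le> grid_norm h (grid \<Omega> h) (g_init \<Omega> h f0) \<and>
                    grid_norm h (grid \<Omega> h) (g_init \<Omega> h f0) \<le> L2_norm \<Omega> f0))"
proof -
  \<comment> \<open>The velocity data enter the solvability and the energy bound through this
    discrete divergence constraint.\<close>
  have div: "\<forall>n<N. \<forall>x\<in>grid_interior h (grid \<Omega> h). div_minus h (w_data \<Omega> h \<tau> v n) x = 0"
    using helmholtz_proj_div_free \<open>bounded \<Omega>\<close> \<open>h > 0\<close> by (simp add: w_data_def)
  have g0: "g_init \<Omega> h f0 \<in> grid_fun (grid \<Omega> h)"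
    by (simp add: grid_fun_def g_init_def)
  have L2: "f0 \<in> L2_space \<Omega>"
    using \<open>admissible_initial \<Omega> f0\<close> by (simp add: admissible_initial_def)
  show ?thesis
    using solves_scheme_ex1[OF \<open>bounded \<Omega>\<close> \<open>h > 0\<close> \<open>\<tau> > 0\<close> g0 div]
      solves_scheme_norm_le[OF \<open>bounded \<Omega>\<close> \<open>h > 0\<close> \<open>\<tau> > 0\<close> div]
      grid_norm_g_init_le[OF \<open>open \<Omega>\<close> \<open>bounded \<Omega>\<close> \<open>h > 0\<close> L2]
    by blast
qed

end
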